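(* For every integer $n\geq 4$, the graph $G(L(A_n))$ has a Hamiltonian cycle, where $A_n$ is the associahedron.
   Context: The associahedron $A_n$ is the $(n-3)$-dimensional polytope whose nonempty faces correspond to dissections of a convex $n$-gon (sets of pairwise non-crossing diagonals), a dissection with $j$ diagonals corresponding to a face of dimension $n-3-j$; the vertices are the triangulations and $A_n$ itself is the dissection with no diagonals. Face inclusion corresponds to reverse inclusion of diagonal sets. $L(A_n)$ is the face lattice (these faces plus the empty face $\emptyset$ as minimum), and $G(L(A_n))$ is its cover graph: two dissections are adjacent iff they differ by adding or removing a single diagonal, and $\emptyset$ is adjacent to every triangulation. *)

theory Defs
  imports "HOL-Analysis.Polytope" "Graph_Theory.Pair_Digraph"
begin

section \<open>Cover graphs and Hamiltonian cycles\<close>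

definition covered_by :: "'a set \<Rightarrow> ('a \<Rightarrow> 'a \<Rightarrow> bool) \<Rightarrow> 'a \<Rightarrow> 'a \<Rightarrow> bool" where
  "covered_by A le x y \<longleftrightarrow>
     x \<in> A \<and> y \<in> A \<and> le x y \<and> x \<noteq> y \<and> (\<forall>z\<in>A. le x z \<and> le z y \<longrightarrow> z = x \<or> z = y)"

text \<open>Undirected graphs are represented as digraphs with a symmetric arc set.\<close>

definition cover_graph :: "'a set \<Rightarrow> ('a \<Rightarrow> 'a \<Rightarrow> bool) \<Rightarrow> 'a pair_pre_digraph" where
  "cover_graph A le =
     \<lparr> pverts = A, parcs = {(x, y). covered_by A le x y \<or> covered_by A le y x} \<rparr>"

text \<open>
  The notion of cycle from the graph library visits no vertex twice, but in a symmetric digraph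
  it admits the closed walk \<open>a, b, a\<close>. The bound on the length rules this out, so that cycles are
  those of the undirected graph. The tails of the arcs of a cycle are exactly its vertices.
\<close>

definition hamiltonian :: "'a pair_pre_digraph \<Rightarrow> bool" where
  "hamiltonian G \<longleftrightarrow>
     (\<exists>p. pre_digraph.cycle (with_proj G) p \<and> 3 \<le> length p \<and> fst ` set p = pverts G)"

lemma pcas_zip: "pcas x (zip (x # ws) (ws @ [y])) y"
  by (induction ws arbitrary: x) auto

lemma pawalk_verts_zip: "pawalk_verts x (zip (x # ws) (ws @ [y])) = x # ws @ [y]"
  by (induction ws arbitrary: x) auto

lemma pcas_imp_zip:
  "pcas u p v \<Longrightarrow> p \<noteq> [] \<Longrightarrow>
     hd (map fst p) = u \<and> map snd p = tl (map fst p) @ [v] \<and> pawalk_verts u p = map fst p @ [v]"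
proof (induction u p v rule: pcas.induct)
  case (2 u e es v)
  then show ?case by (cases es) auto
qed simp

text \<open>Hamiltonicity in terms of a cyclic list of all vertices.\<close>

lemma hamiltonian_iff_list:
  "hamiltonian G \<longleftrightarrow>
     (\<exists>vs. distinct vs \<and> set vs = pverts G \<and> 3 \<le> length vs \<and>
           set (zip vs (rotate1 vs)) \<subseteq> parcs G)" (is "?L \<longleftrightarrow> ?R")
proof
  assume ?L
  then obtain p u where p: "pre_digraph.awalk (with_proj G) u p u"
      "distinct (tl (pawalk_verts u p))" "3 \<le> length p" "fst ` set p = pverts G"
    by (auto simp: hamiltonian_def pre_digraph.cycle_def awalk_verts_with_proj_eq)
  have cas: "pcas u p u" and sub: "set p \<subseteq> parcs G"
    using p(1) by (auto simp: pre_digraph.awalk_def cas_with_proj_eq)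
  have ne: "p \<noteq> []" using p(3) by auto
  note z = pcas_imp_zip[OF cas ne]
  have rot: "map snd p = rotate1 (map fst p)"
    using z ne by (cases p) auto
  have tl: "tl (pawalk_verts u p) = rotate1 (map fst p)"
    using z ne by (cases p) auto
  have "p = zip (map fst p) (rotate1 (map fst p))"
    unfolding rot[symmetric] by (simp add: zip_map_fst_snd)
  moreover have "distinct (map fst p)"
    using p(2) unfolding tl by simp
  ultimately show ?R
    using p(3,4) sub by (intro exI[of _ "map fst p"]) auto
next
  assume ?R
  then obtain vs where vs: "distinct vs" "set vs = pverts G" "3 \<le> length vs"
      "set (zip vs (rotate1 vs)) \<subseteq> parcs G" by blast
  then obtain u ws where uw: "vs = u # ws" by (cases vs) auto
  let ?p = "zip (u # ws) (ws @ [u])"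
  have "pre_digraph.awalk (with_proj G) u ?p u"
    using vs uw pcas_zip[of u ws u]
    by (auto simp: pre_digraph.awalk_def cas_with_proj_eq)
  moreover have "distinct (tl (pre_digraph.awalk_verts (with_proj G) u ?p))"
    using vs(1) uw by (simp only: awalk_verts_with_proj_eq pawalk_verts_zip) simp
  moreover have "?p \<noteq> []" by (cases ws) auto
  ultimately have "pre_digraph.cycle (with_proj G) ?p"
    unfolding pre_digraph.cycle_def by blast
  moreover have "3 \<le> length ?p" using vs(3) uw by simp
  moreover have "fst ` set ?p = pverts G"
  proof -
    have "fst ` set ?p = set (map fst ?p)" by (simp only: set_map)
    also have "map fst ?p = u # ws" by (intro map_fst_zip) simp
    finally show ?thesis using vs(2) uw by simp
  qed
  ultimately show ?L unfolding hamiltonian_def by blast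
qed


section \<open>The face lattice of the associahedron\<close>

text \<open>
  The vertices of the convex \<open>n\<close>-gon are \<open>0, \<dots>, n - 1\<close> in cyclic order, and a diagonal is
  the pair \<open>(i, j)\<close> with \<open>i < j\<close> of its endpoints.
\<close>

definition diagonals :: "nat \<Rightarrow> (nat \<times> nat) set" where
  "diagonals n = {(i, j). i + 1 < j \<and> j < n \<and> \<not> (i = 0 \<and> j = n - 1)}"

text \<open>
  Diagonals of a convex polygon meet in their interiors iff their endpoints
  strictly interleave in the cyclic order.
\<close>

definition crossing :: "nat \<times> nat \<Rightarrow> nat \<times> nat \<Rightarrow> bool" where
  "crossing d e \<longleftrightarrow>
     fst d < fst e \<and> fst e < snd d \<and> snd d < snd e \<or>
     fst e < fst d \<and> fst d < snd e \<and> snd e < snd d"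

definition dissections :: "nat \<Rightarrow> (nat \<times> nat) set set" where
  "dissections n = {D. D \<subseteq> diagonals n \<and> (\<forall>d\<in>D. \<forall>e\<in>D. \<not> crossing d e)}"

definition triangulations :: "nat \<Rightarrow> (nat \<times> nat) set set" where
  "triangulations n = {D \<in> dissections n. \<forall>E\<in>dissections n. D \<subseteq> E \<longrightarrow> E = D}"

text \<open>
  \<open>Empty_Face\<close> is the empty face of the polytope. It must not be confused with
  \<open>Dissection {}\<close>, the dissection without diagonals, which is the whole polytope.
\<close>

datatype assoc_face = Empty_Face | Dissection "(nat \<times> nat) set"

definition assoc_faces :: "nat \<Rightarrow> assoc_face set" where
  "assoc_faces n = insert Empty_Face (Dissection ` dissections n)"

fun assoc_face_le :: "assoc_face \<Rightarrow> assoc_face \<Rightarrow> bool" where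
  "assoc_face_le Empty_Face G \<longleftrightarrow> True"
| "assoc_face_le (Dissection D) Empty_Face \<longleftrightarrow> False"
| "assoc_face_le (Dissection D) (Dissection E) \<longleftrightarrow> E \<subseteq> D"

abbreviation assoc_cover_graph :: "nat \<Rightarrow> assoc_face pair_pre_digraph" where
  "assoc_cover_graph n \<equiv> cover_graph (assoc_faces n) assoc_face_le"


section \<open>Adjacency in the cover graph\<close>

lemma dissections_mono: "D \<in> dissections n \<Longrightarrow> E \<subseteq> D \<Longrightarrow> E \<in> dissections n"
  unfolding dissections_def by blast

lemma covered_by_dissections:
  "covered_by (assoc_faces n) assoc_face_le (Dissection D) (Dissection E) \<longleftrightarrow>
     D \<in> dissections n \<and> (\<exists>d. d \<notin> E \<and> D = insert d E)" (is "?L \<longleftrightarrow> ?R")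
proof
  assume L: ?L
  then have D: "D \<in> dissections n" and E: "E \<in> dissections n" and sub: "E \<subset> D"
    by (auto simp: covered_by_def assoc_faces_def)
  from sub obtain d where d: "d \<in> D" "d \<notin> E" by blast
  then have "insert d E \<in> dissections n"
    using dissections_mono[OF D, of "insert d E"] sub by blast
  then have "Dissection (insert d E) \<in> assoc_faces n" by (simp add: assoc_faces_def)
  with L d sub have "insert d E = D"
    unfolding covered_by_def by (auto dest!: bspec[where x = "Dissection (insert d E)"])
  with D d show ?R by blast
next
  assume ?R
  then obtain d where d: "D \<in> dissections n" "d \<notin> E" "D = insert d E" by blast
  then have "E \<in> dissections n" using dissections_mono[of D n E] by blast
  with d show ?L
    by (auto simp: covered_by_def assoc_faces_def)
qed

lemma assoc_cover_graph_dissections: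
  "(Dissection D, Dissection E) \<in> parcs (assoc_cover_graph n) \<longleftrightarrow>
     D \<in> dissections n \<and> E \<in> dissections n \<and>
     (\<exists>d. d \<notin> E \<and> D = insert d E \<or> d \<notin> D \<and> E = insert d D)"
  unfolding cover_graph_def using dissections_mono
  by (auto simp: covered_by_dissections)

lemma assoc_cover_graph_Empty_Face:
  "(Empty_Face, Dissection D) \<in> parcs (assoc_cover_graph n) \<longleftrightarrow> D \<in> triangulations n"
  by (auto simp: cover_graph_def covered_by_def assoc_faces_def triangulations_def)

lemma assoc_cover_graph_sym:
  "(F, G) \<in> parcs (assoc_cover_graph n) \<longleftrightarrow> (G, F) \<in> parcs (assoc_cover_graph n)"
  by (auto simp: cover_graph_def)


section \<open>Polytopal realizations\<close>

text \<open>
  Polytopes whose face structure is that of the associahedron. The cover graph of their face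
  lattice is isomorphic to the one above, so Hamiltonicity does not depend on the realization.
\<close>

definition is_associahedron :: "nat \<Rightarrow> 'a::euclidean_space set \<Rightarrow> bool" where
  "is_associahedron n P \<longleftrightarrow>
     polytope P \<and> aff_dim P = int n - 3 \<and>
     (\<exists>\<phi>. bij_betw \<phi> (dissections n) {F. F face_of P \<and> F \<noteq> {}} \<and>
          (\<forall>D\<in>dissections n. aff_dim (\<phi> D) = int n - 3 - int (card D)) \<and>
          (\<forall>D\<in>dissections n. \<forall>E\<in>dissections n. \<phi> D \<subseteq> \<phi> E \<longleftrightarrow> E \<subseteq> D))"

lemma hamiltonian_cover_graph_transfer:
  assumes bij: "bij_betw f A B"
    and le: "\<And>x y. x \<in> A \<Longrightarrow> y \<in> A \<Longrightarrow> le' (f x) (f y) \<longleftrightarrow> le x y"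
    and ham: "hamiltonian (cover_graph A le)"
  shows "hamiltonian (cover_graph B le')"
proof -
  have inj: "inj_on f A" and im: "f ` A = B" using bij by (auto simp: bij_betw_def)
  have cov: "covered_by B le' (f x) (f y)" if "covered_by A le x y" for x y
    using that le inj unfolding covered_by_def im[symmetric] by (auto simp: inj_on_eq_iff)
  obtain vs where vs: "distinct vs" "set vs = A" "3 \<le> length vs"
      "set (zip vs (rotate1 vs)) \<subseteq> parcs (cover_graph A le)"
    using ham unfolding hamiltonian_iff_list by (auto simp: cover_graph_def)
  have "set (zip (map f vs) (rotate1 (map f vs))) = map_prod f f ` set (zip vs (rotate1 vs))"
    by (simp add: rotate1_map zip_map_map map_prod_def)
  also have "\<dots> \<subseteq> parcs (cover_graph B le')"
    using vs(4) cov by (fastforce simp: cover_graph_def)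
  finally show ?thesis
    unfolding hamiltonian_iff_list using vs inj im
    by (intro exI[of _ "map f vs"]) (auto simp: distinct_map cover_graph_def)
qed

lemma hamiltonian_is_associahedron_iff:
  assumes "is_associahedron n P"
  shows "hamiltonian (cover_graph {F. F face_of P} (\<subseteq>)) \<longleftrightarrow> hamiltonian (assoc_cover_graph n)"
proof -
  obtain \<phi> where bij: "bij_betw \<phi> (dissections n) {F. F face_of P \<and> F \<noteq> {}}"
    and le: "\<forall>D\<in>dissections n. \<forall>E\<in>dissections n. \<phi> D \<subseteq> \<phi> E \<longleftrightarrow> E \<subseteq> D"
    using assms unfolding is_associahedron_def by (elim conjE exE) (rule that)
  define f where "f = (\<lambda>F. case F of Empty_Face \<Rightarrow> {} | Dissection D \<Rightarrow> \<phi> D)"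
  have inj: "inj_on \<phi> (dissections n)"
    and im: "\<phi> ` dissections n = {F. F face_of P \<and> F \<noteq> {}}"
    using bij by (auto simp: bij_betw_def)
  have ne: "\<phi> D \<noteq> {}" if "D \<in> dissections n" for D using imageI[OF that, of \<phi>] unfolding im by simp
  have "f ` assoc_faces n = insert {} (\<phi> ` dissections n)"
    by (simp add: assoc_faces_def f_def image_image)
  also have "\<dots> = {F. F face_of P}" unfolding im by auto
  finally have fim: "f ` assoc_faces n = {F. F face_of P}" .
  have "inj_on f (assoc_faces n)"
    using inj ne by (auto simp: inj_on_def assoc_faces_def f_def)
  then have fbij: "bij_betw f (assoc_faces n) {F. F face_of P}"
    using fim by (simp add: bij_betw_def)
  have fle: "f F \<subseteq> f G \<longleftrightarrow> assoc_face_le F G" if "F \<in> assoc_faces n" "G \<in> assoc_faces n" for F G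
    using that
  proof (cases F; cases G)
    fix D E assume "F = Dissection D" "G = Dissection E"
    with that le show ?thesis by (simp add: assoc_faces_def f_def image_iff)
  next
    fix D assume "F = Dissection D" "G = Empty_Face"
    with that ne show ?thesis by (simp add: assoc_faces_def f_def image_iff)
  qed (simp_all add: f_def)
  let ?g = "inv_into (assoc_faces n) f"
  have gbij: "bij_betw ?g {F. F face_of P} (assoc_faces n)"
    using fbij by (rule bij_betw_inv_into)
  have gle: "assoc_face_le (?g F) (?g G) \<longleftrightarrow> F \<subseteq> G"
    if "F \<in> {F. F face_of P}" "G \<in> {F. F face_of P}" for F G
    using fle[of "?g F" "?g G"] bij_betw_inv_into_right[OF fbij that(1)]
      bij_betw_inv_into_right[OF fbij that(2)] bij_betwE[OF gbij] that by simp
  show ?thesis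
  proof
    assume "hamiltonian (assoc_cover_graph n)"
    then show "hamiltonian (cover_graph {F. F face_of P} (\<subseteq>))"
      by (rule hamiltonian_cover_graph_transfer[where le' = "(\<subseteq>)", OF fbij, rotated]) (rule fle)
  next
    assume "hamiltonian (cover_graph {F. F face_of P} (\<subseteq>))"
    then show "hamiltonian (assoc_cover_graph n)"
      by (rule hamiltonian_cover_graph_transfer[where le' = assoc_face_le, OF gbij, rotated]) (rule gle)
  qed
qed

end

theory Submission
  imports Defs
begin

text \<open>
  Removing the empty face turns a Hamiltonian cycle into a Hamiltonian path through the dissections
  whose two ends are triangulations. Such paths, of odd length, are built by induction, contracting
  the side \<open>(m, m + 1)\<close> of the \<open>(m + 2)\<close>-gon. Given a dissection \<open>D\<close> of the \<open>(m + 1)\<close>-gon, let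
  \<open>0 = a\<^sub>0 < \<dots> < a\<^sub>k = m - 1\<close> be the vertices joined to \<open>m\<close> by a diagonal of \<open>D\<close> or by a side. The
  dissections that contract to \<open>D\<close> are given by an index \<open>i\<close>: the edges from \<open>a\<^sub>0, \<dots>, a\<^sub>i\<close> go to
  \<open>m + 1\<close>, and those from \<open>a\<^sub>i, \<dots>, a\<^sub>k\<close> (or from \<open>a\<^bsub>i+1\<^esub>, \<dots>, a\<^sub>k\<close>, if \<open>i < k\<close>) go to \<open>m\<close>. Taking
  the two kinds in turn for \<open>i = 0, \<dots>, k\<close> gives a path with \<open>2 k + 1\<close> elements through the fiber
  over \<open>D\<close>, whose ends are triangulations if \<open>D\<close> is one. The fibers of adjacent dissections have
  adjacent first elements and adjacent last elements, so a path through the dissections of the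
  \<open>(m + 1)\<close>-gon lifts by running through the fibers alternately forwards and backwards.
\<close>

definition adj :: "'a set \<Rightarrow> 'a set \<Rightarrow> bool" where
  "adj D E \<longleftrightarrow> (\<exists>d. d \<notin> E \<and> D = insert d E \<or> d \<notin> D \<and> E = insert d D)"

lemma adj_sym: "adj D E \<longleftrightarrow> adj E D"
  unfolding adj_def by blast

lemma adj_insert: "d \<notin> D \<Longrightarrow> adj D (insert d D)" "d \<notin> D \<Longrightarrow> adj (insert d D) D"
  unfolding adj_def by blast+

section \<open>Interleaving and alternating lists\<close>

text \<open>The last element gets no \<open>g\<close>-value: in a fiber, \<open>g a\<close> is the
  intermediate stage between \<open>a\<close> and its successor.\<close>

fun weave :: "('a \<Rightarrow> 'b) \<Rightarrow> ('a \<Rightarrow> 'b) \<Rightarrow> 'a list \<Rightarrow> 'b list" where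
  "weave f g [] = []"
| "weave f g [a] = [f a]"
| "weave f g (a # b # as) = f a # g a # weave f g (b # as)"

lemma weave_eq_Nil_iff [simp]: "weave f g as = [] \<longleftrightarrow> as = []"
  by (induction f g as rule: weave.induct) auto

lemma hd_weave: "as \<noteq> [] \<Longrightarrow> hd (weave f g as) = f (hd as)"
  by (induction f g as rule: weave.induct) auto

lemma last_weave: "as \<noteq> [] \<Longrightarrow> last (weave f g as) = f (last as)"
  by (induction f g as rule: weave.induct) auto

lemma odd_length_weave: "as \<noteq> [] \<Longrightarrow> odd (length (weave f g as))"
  by (induction f g as rule: weave.induct) auto

lemma set_weave: "set (weave f g as) = f ` set as \<union> g ` set (butlast as)"
  by (induction f g as rule: weave.induct) auto

lemma distinct_weave:
  assumes "distinct as" "\<And>a. a \<in> set (butlast as) \<Longrightarrow> f a \<noteq> g a"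
    and "\<And>a b. a \<in> set as \<Longrightarrow> b \<in> set as \<Longrightarrow> a \<noteq> b \<Longrightarrow> f a \<noteq> f b \<and> f a \<noteq> g b \<and> g a \<noteq> g b"
  shows "distinct (weave f g as)"
  using assms
proof (induction f g as rule: weave.induct)
  case (3 f g a b as)
  have "distinct (weave f g (b # as))"
    using 3 by (intro 3(1)) auto
  moreover have "c \<in> set as \<or> c = b" if "c \<in> set (butlast (b # as))" for c
    using in_set_butlastD[OF that] by auto
  then have "f a \<notin> set (weave f g (b # as))" "g a \<notin> set (weave f g (b # as))"
    using 3(2) 3(4)[of a] 3(4)[of _ a] unfolding set_weave by fastforce+
  moreover have "f a \<noteq> g a" using 3(3) by simp
  ultimately show ?case by simp
qed auto

lemma successively_weave:
  assumes "\<And>a. a \<in> set (butlast as) \<Longrightarrow> R (f a) (g a)"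
    and "successively (\<lambda>a b. R (g a) (f b)) as"
  shows "successively R (weave f g as)"
  using assms
proof (induction f g as rule: weave.induct)
  case (3 f g a b as)
  then show ?case by (auto simp: successively_Cons hd_weave)
qed auto

section \<open>Concatenating paths in alternating directions\<close>

fun zigzag :: "('a \<Rightarrow> 'b list) \<Rightarrow> bool \<Rightarrow> 'a list \<Rightarrow> 'b list" where
  "zigzag f b [] = []"
| "zigzag f b (x # xs) = (if b then f x else rev (f x)) @ zigzag f (\<not> b) xs"

lemma set_zigzag: "set (zigzag f b xs) = (\<Union>x\<in>set xs. set (f x))"
  by (induction f b xs rule: zigzag.induct) auto

lemma distinct_zigzag:
  assumes "distinct xs" "\<And>x. x \<in> set xs \<Longrightarrow> distinct (f x)"
    and "\<And>x y. x \<in> set xs \<Longrightarrow> y \<in> set xs \<Longrightarrow> x \<noteq> y \<Longrightarrow> set (f x) \<inter> set (f y) = {}"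
  shows "distinct (zigzag f b xs)"
  using assms
proof (induction f b xs rule: zigzag.induct)
  case (2 f b x xs)
  have "distinct (zigzag f (\<not> b) xs)" using 2 by (intro 2(1)) auto
  moreover have "set (f x) \<inter> set (f y) = {}" if "y \<in> set xs" for y
    using 2(2) that by (intro 2(4)) auto
  ultimately show ?case using 2(3) by (auto simp: set_zigzag)
qed auto

lemma hd_zigzag:
  "xs \<noteq> [] \<Longrightarrow> f (hd xs) \<noteq> [] \<Longrightarrow>
    hd (zigzag f b xs) = (if b then hd (f (hd xs)) else last (f (hd xs)))"
  by (cases xs) (auto simp: hd_rev)

text \<open>Where a forward list meets the next, reversed one, two last elements meet; at the next
  junction, two heads. So only ends of the same kind have to be related.\<close>

lemma successively_zigzag:
  assumes "successively P xs" "\<And>x. x \<in> set xs \<Longrightarrow> f x \<noteq> [] \<and> successively R (f x)"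
    and "\<And>x y. R x y \<Longrightarrow> R y x"
    and "\<And>x y. x \<in> set xs \<Longrightarrow> y \<in> set xs \<Longrightarrow> P x y \<Longrightarrow> R (hd (f x)) (hd (f y)) \<and> R (last (f x)) (last (f y))"
  shows "successively R (zigzag f b xs)"
  using assms
proof (induction f b xs rule: zigzag.induct)
  case (2 f b x xs)
  have IH: "successively R (zigzag f (\<not> b) xs)"
  proof (rule "2.IH")
    show "successively P xs" using 2(2) by (auto simp: successively_Cons)
    show "R y x" if "R x y" for x y using that by (rule 2(4))
    show "f y \<noteq> [] \<and> successively R (f y)" if "y \<in> set xs" for y
      using that by (intro 2(3)) simp
    show "R (hd (f y)) (hd (f z)) \<and> R (last (f y)) (last (f z))"
      if "y \<in> set xs" "z \<in> set xs" "P y z" for y z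
      using that by (intro 2(5)) simp_all
  qed
  have fx: "f x \<noteq> []" "successively R (f x)" using 2(3)[of x] by auto
  have "successively R (rev (f x))"
    unfolding successively_rev using fx(2) by (rule successively_mono) (rule 2(4))
  moreover have "R (if b then last (f x) else hd (f x)) (hd (zigzag f (\<not> b) xs))" if "xs \<noteq> []"
  proof -
    have "P x (hd xs)" "f (hd xs) \<noteq> []" using 2(2) 2(3)[of "hd xs"] that by (auto simp: successively_Cons)
    then show ?thesis using 2(5)[of x "hd xs"] that by (simp add: hd_zigzag)
  qed
  ultimately show ?case
    using IH fx by (cases "xs = []") (auto simp: successively_append_iff last_rev)
qed simp

text \<open>The direction flips with every list, so the last list is read in the initial direction
  exactly when the number of lists is odd.\<close>

lemma last_zigzag:
  assumes "xs \<noteq> []" "\<And>x. x \<in> set xs \<Longrightarrow> f x \<noteq> []"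
  shows "last (zigzag f b xs) = (if b \<longleftrightarrow> odd (length xs) then last (f (last xs)) else hd (f (last xs)))"
  using assms
proof (induction f b xs rule: zigzag.induct)
  case (2 f b x xs)
  show ?case
  proof (cases xs)
    case Nil
    then show ?thesis using 2(3) by (auto simp: last_rev)
  next
    case (Cons y ys)
    then have "zigzag f (\<not> b) xs \<noteq> []" using 2(3)[of y] by simp
    then show ?thesis using 2 Cons by auto
  qed
qed auto

lemma odd_length_zigzag:
  assumes "\<And>x. x \<in> set xs \<Longrightarrow> odd (length (f x))"
  shows "odd (length (zigzag f b xs)) \<longleftrightarrow> odd (length xs)"
  using assms by (induction f b xs rule: zigzag.induct) auto

lemma hd_sorted_zero: "sorted as \<Longrightarrow> 0 \<in> set as \<Longrightarrow> hd as = (0::nat)"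
  by (cases as) auto

lemma sorted_le_last: "sorted as \<Longrightarrow> x \<in> set as \<Longrightarrow> x \<le> last as"
  by (cases as rule: rev_cases) (auto simp: sorted_append)

lemma set_butlast_distinct: "distinct as \<Longrightarrow> as \<noteq> [] \<Longrightarrow> set (butlast as) = set as - {last as}"
  by (cases as rule: rev_cases) auto

section \<open>Contracting a side of the polygon\<close>

text \<open>For a dissection of the \<open>(m + 2)\<close>-gon, the bounds on \<open>i\<close>
  discard just \<open>(0, m)\<close> and \<open>(m - 1, m + 1)\<close>, the two diagonals that
  become sides.\<close>

definition contract :: "nat \<Rightarrow> (nat \<times> nat) set \<Rightarrow> (nat \<times> nat) set" where
  "contract m E = {(i, j) \<in> E. j < m} \<union>
     {(i, m) | i. 0 < i \<and> i + 1 < m \<and> ((i, m) \<in> E \<or> (i, m + 1) \<in> E)}"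

text \<open>\<open>0\<close> and \<open>m - 1\<close> stand for the sides of the \<open>(m + 1)\<close>-gon at the vertex \<open>m\<close>.\<close>

definition spine :: "nat \<Rightarrow> (nat \<times> nat) set \<Rightarrow> nat set" where
  "spine m D = {i. i = 0 \<or> i + 1 = m \<or> (i, m) \<in> D}"

text \<open>Spine vertices up to \<open>a\<close> are joined to \<open>m + 1\<close>, those from
  \<open>b\<close> on to \<open>m\<close>. The bounds \<open>0 < i\<close> and
  \<open>i + 1 < m\<close> leave out the sides \<open>(0, m + 1)\<close> and
  \<open>(m - 1, m)\<close>.\<close>

definition expand :: "nat \<Rightarrow> (nat \<times> nat) set \<Rightarrow> nat \<Rightarrow> nat \<Rightarrow> (nat \<times> nat) set" where
  "expand m D a b = {(i, j) \<in> D. j < m} \<union> {(i, m + 1) | i. i \<in> spine m D \<and> 0 < i \<and> i \<le> a} \<union>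
     {(i, m) | i. i \<in> spine m D \<and> b \<le> i \<and> i + 1 < m}"

text \<open>In the first kind of member, the cell at the side \<open>(m, m + 1)\<close> is the
  triangle with apex \<open>a\<close>; in the second, it is a cell of \<open>D\<close> at
  \<open>m\<close> enlarged by one vertex.\<close>

definition fiber :: "nat \<Rightarrow> (nat \<times> nat) set \<Rightarrow> (nat \<times> nat) set list" where
  "fiber m D = weave (\<lambda>a. expand m D a a) (\<lambda>a. expand m D a (a + 1)) (sorted_list_of_set (spine m D))"

section \<open>Contraction and expansion of dissections\<close>

lemma dissectionD:
  assumes "D \<in> dissections n" "(i, j) \<in> D"
  shows "i + 1 < j" "j < n" "i = 0 \<Longrightarrow> j + 1 \<noteq> n"
  using assms unfolding dissections_def diagonals_def by auto

lemma dissection_noncrossing: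
  assumes "D \<in> dissections n" "(i, j) \<in> D" "(k, l) \<in> D" "i < k" "k < j" "j < l"
  shows False
  using assms unfolding dissections_def crossing_def by fastforce

lemma dissection_cases:
  assumes "D \<in> dissections (m + 1)" "(i, j) \<in> D"
  shows "j < m \<or> j = m \<and> 0 < i \<and> i + 1 < m"
  using dissectionD[OF assms] by linarith

lemma dissectionI:
  assumes "\<And>i j. (i, j) \<in> D \<Longrightarrow> i + 1 < j \<and> j < n \<and> (i = 0 \<longrightarrow> j + 1 \<noteq> n)"
    and "\<And>i j k l. (i, j) \<in> D \<Longrightarrow> (k, l) \<in> D \<Longrightarrow> i < k \<Longrightarrow> k < j \<Longrightarrow> j < l \<Longrightarrow> False"
  shows "D \<in> dissections n"
  using assms unfolding dissections_def diagonals_def crossing_def by fastforce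

text \<open>Merging \<open>m\<close> and \<open>m + 1\<close> creates no crossing: a diagonal ending
  before \<open>m\<close> crosses \<open>(k, m)\<close> iff it crosses
  \<open>(k, m + 1)\<close>.\<close>

lemma contract_dissection:
  assumes "E \<in> dissections (m + 2)"
  shows "contract m E \<in> dissections (m + 1)"
proof (rule dissectionI)
  show "i + 1 < j \<and> j < m + 1 \<and> (i = 0 \<longrightarrow> j + 1 \<noteq> m + 1)" if "(i, j) \<in> contract m E" for i j
    using that dissectionD[OF assms] by (auto simp: contract_def)
  show False if "(i, j) \<in> contract m E" "(k, l) \<in> contract m E" "i < k" "k < j" "j < l" for i j k l
    using that dissection_noncrossing[OF assms, of i j k l]
      dissection_noncrossing[OF assms, of i j k "m + 1"] by (auto simp: contract_def)
qed

lemma contract_mono: "E \<subseteq> F \<Longrightarrow> contract m E \<subseteq> contract m F"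
  unfolding contract_def by auto

lemma spine_less:
  assumes "2 \<le> m" "D \<in> dissections (m + 1)" "i \<in> spine m D"
  shows "i < m"
proof -
  have "(i, m) \<in> D \<Longrightarrow> i < m" using dissection_cases[OF assms(2), of i m] by linarith
  then show ?thesis using assms(1,3) unfolding spine_def by auto
qed

lemma finite_spine:
  assumes "2 \<le> m" "D \<in> dissections (m + 1)"
  shows "finite (spine m D)"
proof (rule finite_subset)
  show "spine m D \<subseteq> {..<m}" using spine_less[OF assms] by blast
qed simp

text \<open>The only new danger is \<open>(i, m)\<close> crossing \<open>(k, m + 1)\<close> with
  \<open>i < k\<close>, but then \<open>b \<le> i < k \<le> a\<close>.\<close>

lemma expand_dissection:
  assumes "2 \<le> m" "D \<in> dissections (m + 1)" "a \<le> b"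
  shows "expand m D a b \<in> dissections (m + 2)"
proof (rule dissectionI)
  show "i + 1 < j \<and> j < m + 2 \<and> (i = 0 \<longrightarrow> j + 1 \<noteq> m + 2)" if "(i, j) \<in> expand m D a b" for i j
    using that dissectionD[OF assms(2), of i j] spine_less[OF assms(1,2), of i]
    by (auto simp: expand_def)
  show False if "(i, j) \<in> expand m D a b" "(k, l) \<in> expand m D a b" "i < k" "k < j" "j < l" for i j k l
  proof (cases "j < m")
    case True
    \<comment> \<open>Since \<open>0 < k\<close> and \<open>k + 1 < m\<close> here, \<open>k\<close>
      is in the spine because of a diagonal \<open>(k, m)\<close> of \<open>D\<close>, not because
      of a side.\<close>
    then have "(i, j) \<in> D" "(k, l) \<in> D \<or> (k, m) \<in> D"
      using that by (auto simp: expand_def spine_def)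
    then show ?thesis using that True dissection_noncrossing[OF assms(2)] by blast
  next
    case False
    then have "b \<le> i" "k \<le> a" using that by (auto simp: expand_def)
    then show ?thesis using that(3) assms(3) by simp
  qed
qed

text \<open>The bound on \<open>b\<close> ensures that every spine vertex keeps an edge to
  \<open>m\<close> or to \<open>m + 1\<close>, so no diagonal is lost.\<close>

lemma contract_expand:
  assumes "2 \<le> m" "D \<in> dissections (m + 1)" "b \<le> a + 1"
  shows "contract m (expand m D a b) = D"
proof -
  have "(i, j) \<in> contract m (expand m D a b) \<longleftrightarrow> (i, j) \<in> D" for i j
  proof (cases "j = m")
    case True
    have "(i, m) \<in> D \<Longrightarrow> 0 < i \<and> i + 1 < m"
      using dissectionD[OF assms(2), of i m] by fastforce
    then show ?thesis
      unfolding True using assms(3) by (auto simp: contract_def expand_def spine_def)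
  next
    case False
    then show ?thesis
      using dissectionD(2)[OF assms(2), of i j] by (auto simp: contract_def expand_def)
  qed
  then show ?thesis by auto
qed

section \<open>Members, ends and steps of a fiber\<close>

lemma spine_list:
  assumes "2 \<le> m" "D \<in> dissections (m + 1)"
  shows "sorted_list_of_set (spine m D) \<noteq> []"
    and "set (sorted_list_of_set (spine m D)) = spine m D"
    and "hd (sorted_list_of_set (spine m D)) = 0"
    and "last (sorted_list_of_set (spine m D)) = m - 1"
    and "set (butlast (sorted_list_of_set (spine m D))) = spine m D - {m - 1}"
proof -
  let ?as = "sorted_list_of_set (spine m D)"
  show set: "set ?as = spine m D"
    by (rule set_sorted_list_of_set) (rule finite_spine[OF assms])
  have ends: "0 \<in> set ?as" "m - 1 \<in> set ?as" using assms(1) unfolding set by (auto simp: spine_def)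
  then show nil: "?as \<noteq> []" by (metis empty_iff empty_set)
  show "hd ?as = 0" by (rule hd_sorted_zero) (simp, rule ends(1))
  have "last ?as \<in> spine m D" using last_in_set[OF nil] unfolding set .
  then have "last ?as < m" by (rule spine_less[OF assms])
  moreover have "m - 1 \<le> last ?as" by (rule sorted_le_last) (simp, rule ends(2))
  ultimately show last: "last ?as = m - 1" by linarith
  have "set (butlast ?as) = set ?as - {last ?as}" by (rule set_butlast_distinct) (simp, rule nil)
  then show "set (butlast ?as) = spine m D - {m - 1}" unfolding set last .
qed

lemma fiber_nonempty: "2 \<le> m \<Longrightarrow> D \<in> dissections (m + 1) \<Longrightarrow> fiber m D \<noteq> []"
  by (metis fiber_def weave_eq_Nil_iff spine_list(1))

lemma odd_length_fiber: "2 \<le> m \<Longrightarrow> D \<in> dissections (m + 1) \<Longrightarrow> odd (length (fiber m D))"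
  by (metis fiber_def odd_length_weave spine_list(1))

text \<open>For \<open>a = 0\<close> no diagonal moves to \<open>m + 1\<close>, and the former side
  \<open>(0, m)\<close> has become a diagonal.\<close>

lemma hd_fiber:
  assumes "2 \<le> m" "D \<in> dissections (m + 1)"
  shows "hd (fiber m D) = insert (0, m) D"
proof -
  have "i \<in> spine m D \<and> i + 1 < m \<longleftrightarrow> i = 0 \<or> (i, m) \<in> D" for i
    using assms(1) dissection_cases[OF assms(2), of i m] unfolding spine_def by force
  then have "expand m D 0 0 = {(i, j) \<in> D. j < m} \<union> {(i, m) | i. i = 0 \<or> (i, m) \<in> D}"
    unfolding expand_def by auto
  also have "\<dots> = insert (0, m) D"
    using dissection_cases[OF assms(2)] by fastforce
  finally show ?thesis
    unfolding fiber_def hd_weave[OF spine_list(1)[OF assms]] spine_list(3)[OF assms] .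
qed

definition shift :: "nat \<Rightarrow> nat \<times> nat \<Rightarrow> nat \<times> nat" where
  "shift m d = (if snd d = m then (fst d, m + 1) else d)"

text \<open>For \<open>a = m - 1\<close> every diagonal at \<open>m\<close> moves to
  \<open>m + 1\<close>, and the former side at \<open>m - 1\<close> becomes
  \<open>(m - 1, m + 1)\<close>.\<close>

lemma last_fiber:
  assumes "2 \<le> m" "D \<in> dissections (m + 1)"
  shows "last (fiber m D) = insert (m - 1, m + 1) (shift m ` D)"
proof -
  have "shift m ` D = {(i, j) \<in> D. j \<noteq> m} \<union> {(i, m + 1) | i. (i, m) \<in> D}"
    by (force simp: shift_def image_iff)
  moreover have "{(i, j) \<in> D. j \<noteq> m} = {(i, j) \<in> D. j < m}"
    using dissection_cases[OF assms(2)] by fastforce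
  moreover have "i \<in> spine m D \<and> 0 < i \<and> i \<le> m - 1 \<longleftrightarrow> i = m - 1 \<or> (i, m) \<in> D" for i
    using assms(1) dissection_cases[OF assms(2), of i m] unfolding spine_def by force
  then have "expand m D (m - 1) (m - 1) =
      {(i, j) \<in> D. j < m} \<union> {(i, m + 1) | i. i = m - 1 \<or> (i, m) \<in> D}"
    unfolding expand_def by auto
  ultimately have "expand m D (m - 1) (m - 1) = insert (m - 1, m + 1) (shift m ` D)"
    by auto
  then show ?thesis unfolding fiber_def last_weave[OF spine_list(1)[OF assms]] spine_list(4)[OF assms] .
qed

text \<open>For the converse, the index is read off \<open>E\<close>: \<open>a\<close> is its last
  vertex joined to \<open>m + 1\<close>, and \<open>b\<close> records whether \<open>a\<close> is
  also joined to \<open>m\<close>.\<close>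

lemma mem_fiber_iff:
  assumes "2 \<le> m" "D \<in> dissections (m + 1)"
  shows "E \<in> set (fiber m D) \<longleftrightarrow> E \<in> dissections (m + 2) \<and> contract m E = D"
proof
  assume "E \<in> set (fiber m D)"
  then show "E \<in> dissections (m + 2) \<and> contract m E = D"
    unfolding fiber_def set_weave
    using expand_dissection[OF assms] contract_expand[OF assms] by auto
next
  assume "E \<in> dissections (m + 2) \<and> contract m E = D"
  then have E: "E \<in> dissections (m + 2)" and D: "D = contract m E" by auto
  \<comment> \<open>The inserted \<open>0\<close> stands for the side \<open>(0, m + 1)\<close>,
    which is not a diagonal.\<close>
  define a where "a = Max (insert 0 {i. (i, m + 1) \<in> E})"
  have fin: "finite (insert 0 {i. (i, m + 1) \<in> E})"
    using dissectionD(1)[OF E] by (auto intro!: finite_subset[of _ "{..m}"]) fastforce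
  have a_in: "a = 0 \<or> (a, m + 1) \<in> E"
    using Max_in[OF fin] unfolding a_def by auto
  have a_max: "i \<le> a" if "(i, m + 1) \<in> E" for i
    using Max_ge[OF fin] that unfolding a_def by auto
  have a_spine: "a \<in> spine m D"
    using a_in dissectionD[OF E, of a "m + 1"] by (auto simp: spine_def D contract_def)
  \<comment> \<open>Such an edge would cross \<open>(a, m + 1)\<close>.\<close>
  have below: "(i, m) \<notin> E" if "i < a" for i
    using dissection_noncrossing[OF E, of i m a "m + 1"] that a_in dissectionD[OF E, of a "m + 1"] by auto
  \<comment> \<open>If \<open>a + 1 = m\<close>, then \<open>a\<close> is joined to \<open>m\<close>
    by a side.\<close>
  define b where "b = (if a + 1 = m \<or> (a, m) \<in> E then a else a + 1)"
  have "(i, j) \<in> E \<longleftrightarrow> (i, j) \<in> expand m D a b" for i j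
  proof -
    consider "j < m" | "j = m" | "j = m + 1" | "m + 1 < j" by linarith
    then show ?thesis
    proof cases
      case 1
      then show ?thesis by (auto simp: D contract_def expand_def)
    next
      case 2
      have "i \<in> spine m D \<and> b \<le> i \<and> i + 1 < m" if "(i, m) \<in> E"
      proof -
        have "i + 1 < m" using dissectionD(1)[OF E that] .
        moreover have "i \<in> spine m D" using that calculation by (auto simp: spine_def D contract_def)
        moreover have "a \<le> i" using below[of i] that by fastforce
        then have "b \<le> i" using that by (cases "i = a") (auto simp: b_def)
        ultimately show ?thesis by blast
      qed
      moreover have "(i, m) \<in> E" if i: "i \<in> spine m D" "b \<le> i" "i + 1 < m"
      proof (cases "i = a")
        case True
        then show ?thesis using i by (auto simp: b_def split: if_splits)
      next
        case False
        then have "a < i" using i(2) by (auto simp: b_def split: if_splits)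
        \<comment> \<open>Beyond \<open>a\<close> nothing reaches \<open>m + 1\<close>, so the
          diagonal \<open>(i, m)\<close> of \<open>D\<close> can only come from
          \<open>(i, m)\<close> itself.\<close>
        then have "(i, m + 1) \<notin> E" "(i, m) \<in> D" using a_max[of i] i by (auto simp: spine_def)
        then show ?thesis by (auto simp: D contract_def)
      qed
      ultimately show ?thesis unfolding 2 by (auto simp: expand_def)
    next
      case 3
      have "i \<in> spine m D \<and> 0 < i \<and> i \<le> a" if "(i, m + 1) \<in> E"
        using a_max[OF that] dissectionD[OF E that] that by (auto simp: spine_def D contract_def)
      moreover have "(i, m + 1) \<in> E" if i: "i \<in> spine m D" "0 < i" "i \<le> a"
      proof (cases "i = a")
        case True
        then show ?thesis using i(2) a_in by auto
      next
        case False
        then have "i < a" using i(3) by simp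
        then have "(i, m) \<notin> E" "(i, m) \<in> D"
          using below[of i] i spine_less[OF assms a_spine] by (auto simp: spine_def)
        then show ?thesis by (auto simp: D contract_def)
      qed
      ultimately show ?thesis unfolding 3 by (auto simp: expand_def)
    next
      case 4
      then show ?thesis using dissectionD(2)[OF E, of i j] by (auto simp: expand_def)
    qed
  qed
  then have "E = expand m D a b" by auto
  moreover have "b = a \<or> a \<in> spine m D - {m - 1} \<and> b = a + 1"
    using a_spine assms(1) by (auto simp: b_def)
  ultimately show "E \<in> set (fiber m D)"
    using a_spine unfolding fiber_def set_weave spine_list(2,5)[OF assms] by blast
qed

text \<open>The two members at \<open>a\<close> differ in \<open>(a, m)\<close>; for
  \<open>a < b\<close>, the diagonal \<open>(b, m + 1)\<close> separates those at \<open>a\<close>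
  from those at \<open>b\<close>.\<close>

lemma distinct_fiber:
  assumes "2 \<le> m" "D \<in> dissections (m + 1)"
  shows "distinct (fiber m D)"
  unfolding fiber_def
proof (rule distinct_weave)
  show "distinct (sorted_list_of_set (spine m D))" by simp
  show "expand m D a a \<noteq> expand m D a (a + 1)"
    if "a \<in> set (butlast (sorted_list_of_set (spine m D)))" for a
  proof -
    have "a \<in> spine m D" "a + 1 < m"
      using that spine_less[OF assms, of a] unfolding spine_list(5)[OF assms] by auto
    then have "(a, m) \<in> expand m D a a" "(a, m) \<notin> expand m D a (a + 1)"
      by (auto simp: expand_def)
    then show ?thesis by metis
  qed
  have ne: "expand m D a c \<noteq> expand m D b d" if "a \<in> spine m D" "a < b" "b \<in> spine m D" for a b c d
  proof -
    have "(b, m + 1) \<in> expand m D b d" "(b, m + 1) \<notin> expand m D a c"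
      using that by (auto simp: expand_def)
    then show ?thesis by metis
  qed
  show "expand m D a a \<noteq> expand m D b b \<and> expand m D a a \<noteq> expand m D b (b + 1) \<and>
      expand m D a (a + 1) \<noteq> expand m D b (b + 1)"
    if "a \<in> set (sorted_list_of_set (spine m D))" "b \<in> set (sorted_list_of_set (spine m D))" "a \<noteq> b" for a b
    using that ne[of a b] ne[of b a] unfolding spine_list(2)[OF assms]
    by (metis linorder_neqE_nat)
qed

lemma successively_sorted_list_of_set:
  fixes A :: "'a::linorder set"
  assumes "finite A"
  shows "successively (\<lambda>a b. a \<in> A \<and> b \<in> A \<and> a < b \<and> {a<..<b} \<inter> A = {}) (sorted_list_of_set A)"
proof -
  have "successively (\<lambda>a b. a \<in> set xs \<and> b \<in> set xs \<and> a < b \<and> {a<..<b} \<inter> set xs = {}) xs"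
    if "sorted_wrt (<) xs" for xs :: "'a list"
    using that
  proof (induction xs)
    case (Cons x xs)
    then have "successively (\<lambda>a b. a \<in> set xs \<and> b \<in> set xs \<and> a < b \<and> {a<..<b} \<inter> set xs = {}) xs"
      by simp
    then have "successively (\<lambda>a b. a \<in> set (x # xs) \<and> b \<in> set (x # xs) \<and> a < b \<and>
        {a<..<b} \<inter> set (x # xs) = {}) xs"
      \<comment> \<open>The new head is below all of \<open>xs\<close>, so it lies in none of the
        gaps.\<close>
      by (rule successively_mono) (use Cons.prems in fastforce)
    then show ?case using Cons.prems by (cases xs) fastforce+
  qed simp
  from this[of "sorted_list_of_set A"] show ?thesis using assms by simp
qed

text \<open>Along the fiber the spine edges slide from \<open>m\<close> to \<open>m + 1\<close> one
  at a time: \<open>(a, m)\<close> is removed, then \<open>(b, m + 1)\<close> is added for the next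
  spine vertex \<open>b\<close>.\<close>

lemma successively_fiber:
  assumes "2 \<le> m" "D \<in> dissections (m + 1)"
  shows "successively adj (fiber m D)"
  unfolding fiber_def
proof (rule successively_weave)
  show "adj (expand m D a a) (expand m D a (a + 1))"
    if "a \<in> set (butlast (sorted_list_of_set (spine m D)))" for a
  proof -
    have a: "a \<in> spine m D" "a + 1 < m"
      using that spine_less[OF assms, of a] unfolding spine_list(5)[OF assms] by auto
    then have "expand m D a a = insert (a, m) (expand m D a (a + 1))" "(a, m) \<notin> expand m D a (a + 1)"
      by (auto simp: expand_def Suc_le_eq order_le_less)
    then show ?thesis by (metis adj_insert(2))
  qed
  have step: "adj (expand m D a (a + 1)) (expand m D b b)"
    if ab: "a \<in> spine m D" "b \<in> spine m D" "a < b" "{a<..<b} \<inter> spine m D = {}" for a b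
  proof -
    have "i \<le> a \<or> b \<le> i" if "i \<in> spine m D" for i
    proof -
      have "i \<notin> {a<..<b}" using that ab(4) by blast
      then show ?thesis by auto
    qed
    \<comment> \<open>On the spine, \<open>a + 1 \<le> i\<close> and \<open>b \<le> i\<close> are
      equivalent.\<close>
    then have "expand m D b b = insert (b, m + 1) (expand m D a (a + 1))"
      using \<open>a < b\<close> \<open>b \<in> spine m D\<close> unfolding expand_def by fastforce
    moreover have "(b, m + 1) \<notin> expand m D a (a + 1)"
      using \<open>a < b\<close> by (auto simp: expand_def)
    ultimately show ?thesis by (metis adj_insert(1))
  qed
  show "successively (\<lambda>a b. adj (expand m D a (a + 1)) (expand m D b b)) (sorted_list_of_set (spine m D))"
    using successively_sorted_list_of_set[OF finite_spine[OF assms]]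
    by (rule successively_mono) (use step in blast)
qed

section \<open>Fiber ends over adjacent dissections and over triangulations\<close>

lemma adj_insert_cong: "adj D E \<Longrightarrow> d \<notin> D \<Longrightarrow> d \<notin> E \<Longrightarrow> adj (insert d D) (insert d E)"
  unfolding adj_def by (metis insert_commute insert_iff)

lemma adj_image: "adj D E \<Longrightarrow> inj_on f (D \<union> E) \<Longrightarrow> adj (f ` D) (f ` E)"
  unfolding adj_def inj_on_def by (auto; metis)

text \<open>Each end is \<open>D\<close>, or an injective image of it, with a fixed new diagonal, so
  a difference in one diagonal persists.\<close>

lemma adj_fiber_ends:
  assumes m: "2 \<le> m" and D: "D \<in> dissections (m + 1)" and E: "E \<in> dissections (m + 1)" and "adj D E"
  shows "adj (hd (fiber m D)) (hd (fiber m E)) \<and> adj (last (fiber m D)) (last (fiber m E))"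
proof
  show "adj (hd (fiber m D)) (hd (fiber m E))"
    unfolding hd_fiber[OF m D] hd_fiber[OF m E]
    using dissectionD(3)[OF D, of 0 m] dissectionD(3)[OF E, of 0 m] assms(4) by (auto intro: adj_insert_cong)
  have "snd d < m + 1" "fst d + 1 < snd d" if "d \<in> D \<union> E" for d
    using that dissectionD[OF D, of "fst d" "snd d"] dissectionD[OF E, of "fst d" "snd d"] by auto
  note * = this
  \<comment> \<open>No diagonal of the \<open>(m + 1)\<close>-gon ends at \<open>m + 1\<close>, so
    this endpoint marks the moved ones.\<close>
  have "inj_on (shift m) (D \<union> E)"
    using * by (fastforce simp: inj_on_def shift_def prod_eq_iff split: if_splits)
  moreover have "(m - 1, m + 1) \<notin> shift m ` D" "(m - 1, m + 1) \<notin> shift m ` E"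
    using * by (fastforce simp: shift_def split: if_splits)+
  ultimately show "adj (last (fiber m D)) (last (fiber m E))"
    unfolding last_fiber[OF m D] last_fiber[OF m E]
    using assms(4) by (intro adj_insert_cong adj_image)
qed

text \<open>A dissection containing \<open>X\<close> contracts to one containing \<open>D\<close>,
  hence to \<open>D\<close> by maximality. It lies in the fiber and contains \<open>d\<close>, so it
  is \<open>X\<close>.\<close>

lemma triangulation_fiberI:
  assumes m: "2 \<le> m" and D: "D \<in> triangulations (m + 1)" and X: "X \<in> set (fiber m D)" "d \<in> X"
    and unique: "\<And>Y. Y \<in> set (fiber m D) \<Longrightarrow> d \<in> Y \<Longrightarrow> Y = X"
  shows "X \<in> triangulations (m + 2)"
proof -
  have D': "D \<in> dissections (m + 1)" using D by (simp add: triangulations_def)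
  have "E = X" if "E \<in> dissections (m + 2)" "X \<subseteq> E" for E
  proof (rule unique)
    have "contract m E \<in> dissections (m + 1)"
      by (rule contract_dissection) (rule that(1))
    moreover have "contract m X = D" using X(1) mem_fiber_iff[OF m D'] by blast
    then have "D \<subseteq> contract m E" using contract_mono[OF that(2), of m] by simp
    ultimately have "contract m E = D" using D unfolding triangulations_def by blast
    then show "E \<in> set (fiber m D)"
      using that(1) mem_fiber_iff[OF m D'] by blast
    show "d \<in> E" using X(2) that(2) by auto
  qed
  then show ?thesis using X(1) mem_fiber_iff[OF m D'] by (auto simp: triangulations_def)
qed

text \<open>Of the whole fiber, only the first member contains \<open>(0, m)\<close> and only the
  last contains \<open>(m - 1, m + 1)\<close>.\<close>

lemma triangulation_fiber_ends:
  assumes m: "2 \<le> m" and D: "D \<in> triangulations (m + 1)"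
  shows "hd (fiber m D) \<in> triangulations (m + 2)" "last (fiber m D) \<in> triangulations (m + 2)"
proof -
  have D': "D \<in> dissections (m + 1)" using D by (simp add: triangulations_def)
  note fib = fiber_nonempty[OF m D']
  have mem: "\<exists>a\<in>spine m D. E = expand m D a a \<or> a + 1 < m \<and> E = expand m D a (a + 1)"
    if "E \<in> set (fiber m D)" for E
    using that spine_less[OF m D'] unfolding fiber_def set_weave spine_list(2,5)[OF m D'] by fastforce
  have hd: "hd (fiber m D) = expand m D 0 0" and last: "last (fiber m D) = expand m D (m - 1) (m - 1)"
    unfolding fiber_def hd_weave[OF spine_list(1)[OF m D']] last_weave[OF spine_list(1)[OF m D']]
      spine_list(3,4)[OF m D'] by auto
  show "hd (fiber m D) \<in> triangulations (m + 2)"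
  proof (rule triangulation_fiberI[OF m D, where d = "(0, m)"])
    show "(0, m) \<in> hd (fiber m D)" unfolding hd_fiber[OF m D'] by simp
    show "Y = hd (fiber m D)" if "Y \<in> set (fiber m D)" "(0, m) \<in> Y" for Y
      using mem[OF that(1)] that(2) unfolding hd by (auto simp: expand_def)
  qed (use fib in simp)
  show "last (fiber m D) \<in> triangulations (m + 2)"
  proof (rule triangulation_fiberI[OF m D, where d = "(m - 1, m + 1)"])
    show "(m - 1, m + 1) \<in> last (fiber m D)" unfolding last_fiber[OF m D'] by simp
    show "Y = last (fiber m D)" if Y: "Y \<in> set (fiber m D)" "(m - 1, m + 1) \<in> Y" for Y
    proof -
      obtain a where a: "a \<in> spine m D" "Y = expand m D a a \<or> a + 1 < m \<and> Y = expand m D a (a + 1)"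
        using mem[OF Y(1)] by blast
      then have "m - 1 \<le> a" using Y(2) by (auto simp: expand_def)
      then have "a = m - 1" "\<not> a + 1 < m" using spine_less[OF m D' a(1)] by linarith+
      with a(2) show ?thesis unfolding last by blast
    qed
  qed (use fib in simp)
qed

section \<open>Hamiltonian paths between triangulations\<close>

lemma dissections_hamiltonian_path:
  assumes "3 \<le> n"
  shows "\<exists>xs. distinct xs \<and> set xs = dissections n \<and> successively adj xs \<and> odd (length xs) \<and>
           hd xs \<in> triangulations n \<and> last xs \<in> triangulations n"
  using assms
proof (induction n rule: dec_induct)
  \<comment> \<open>The triangle has only the empty dissection, which is both ends of a one-element
    path.\<close>
  case base
  have "diagonals 3 = {}" by (auto simp: diagonals_def)
  then have "dissections 3 = {{}}" "triangulations 3 = {{}}"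
    by (auto simp: dissections_def triangulations_def)
  then show ?case by (intro exI[of _ "[{}]"]) auto
next
  case (step n)
  define m where "m = n - 1"
  have m: "2 \<le> m" and n: "n = m + 1" and sn: "Suc n = m + 2" using step(1) by (auto simp: m_def)
  obtain xs where xs: "distinct xs" "set xs = dissections (m + 1)" "successively adj xs" "odd (length xs)"
      "hd xs \<in> triangulations (m + 1)" "last xs \<in> triangulations (m + 1)"
    using step(3) unfolding n by blast
  have ne: "xs \<noteq> []" using xs(4) by auto
  have f_ne: "fiber m x \<noteq> []" if "x \<in> set xs" for x
    using that fiber_nonempty[OF m] xs(2) by simp
  define ys where "ys = zigzag (fiber m) True xs"
  \<comment> \<open>Fibers over different dissections are disjoint, since their members have
    different contractions.\<close>
  have "distinct ys"
    unfolding ys_def using xs(1,2) distinct_fiber[OF m] mem_fiber_iff[OF m]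
    by (intro distinct_zigzag) auto
  moreover have "set ys = dissections (m + 2)"
    unfolding ys_def set_zigzag xs(2) using contract_dissection[of _ m] mem_fiber_iff[OF m] by auto
  moreover have "successively adj ys"
    unfolding ys_def
  proof (rule successively_zigzag[where P = adj])
    show "adj E D" if "adj D E" for D E :: "(nat \<times> nat) set" using that by (simp add: adj_sym)
  qed (use xs(2,3) f_ne successively_fiber[OF m] adj_fiber_ends[OF m] in auto)
  moreover have "odd (length ys)"
    unfolding ys_def using xs(2,4) odd_length_fiber[OF m] by (subst odd_length_zigzag) auto
  moreover have "hd ys \<in> triangulations (m + 2)"
    unfolding ys_def hd_zigzag[where f = "fiber m", OF ne f_ne[OF hd_in_set[OF ne]]]
    using triangulation_fiber_ends[OF m] xs(5) by simp
  moreover have "last ys \<in> triangulations (m + 2)"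
  proof -
    \<comment> \<open>The number of fibers is odd and the first is read forwards, so the last is
      too.\<close>
    have "last ys = last (fiber m (last xs))"
      unfolding ys_def using last_zigzag[of xs "fiber m" True] ne f_ne xs(4) by simp
    then show ?thesis using triangulation_fiber_ends(2)[OF m xs(6)] by simp
  qed
  ultimately show ?case unfolding sn by blast
qed

text \<open>Brings a path closed by repeating its first vertex into the form used in
  \<open>hamiltonian_iff_list\<close>.\<close>

lemma successively_cyclic_zip:
  assumes "successively P (vs @ [hd vs])" "vs \<noteq> []"
  shows "(a, b) \<in> set (zip vs (rotate1 vs)) \<Longrightarrow> P a b"
proof -
  have "(a, b) \<in> set (zip (x # ws) (ws @ [y])) \<Longrightarrow> successively P (x # ws @ [y]) \<Longrightarrow> P a b" for x y ws
    by (induction ws arbitrary: x) auto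
  then show "(a, b) \<in> set (zip vs (rotate1 vs)) \<Longrightarrow> P a b"
    using assms by (cases vs) simp_all
qed

theorem theorem11:
  fixes n :: nat
  assumes "4 \<le> n"
  shows "hamiltonian (cover_graph (assoc_faces n) assoc_face_le)"
proof -
  have "3 \<le> n" using assms by simp
  from dissections_hamiltonian_path[OF this] obtain xs where xs:
    "distinct xs" "set xs = dissections n" "successively adj xs" "odd (length xs)"
    "hd xs \<in> triangulations n" "last xs \<in> triangulations n" by blast
  have ne: "xs \<noteq> []" using xs(4) by (cases xs) simp_all
  \<comment> \<open>Two dissections and the empty face give the three vertices a cycle needs. For
    \<open>n = 3\<close> the pair \<open>(0, 2)\<close> would be a side.\<close>
  have "{{}, {(0, 2)}} \<subseteq> dissections n"
    using assms by (auto simp: dissections_def diagonals_def crossing_def)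
  then have "card {{}, {(0::nat, 2::nat)}} \<le> card (set xs)"
    unfolding xs(2)[symmetric] by (rule card_mono[rotated]) simp
  then have len: "2 \<le> length xs" using card_length[of xs] by simp
  let ?G = "assoc_cover_graph n"
  let ?R = "\<lambda>F G. (F, G) \<in> parcs ?G"
  let ?vs = "Empty_Face # map Dissection xs"
  have "?R (Dissection D) (Dissection E)" if "D \<in> set xs" "E \<in> set xs" "adj D E" for D E
    using that unfolding assoc_cover_graph_dissections xs(2) adj_def by blast
  then have "successively ?R (map Dissection xs)"
    unfolding successively_map by (rule successively_mono[OF xs(3)])
  moreover have "?R Empty_Face (hd (map Dissection xs))"
    unfolding hd_map[OF ne] assoc_cover_graph_Empty_Face by (rule xs(5))
  moreover have "?R (last (map Dissection xs)) Empty_Face"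
    unfolding last_map[OF ne] assoc_cover_graph_sym[of "Dissection (last xs)"] assoc_cover_graph_Empty_Face
    by (rule xs(6))
  ultimately have "successively ?R (?vs @ [hd ?vs])"
    using ne by (simp add: successively_append_iff successively_Cons del: successively_map)
  then have "?R F G" if "(F, G) \<in> set (zip ?vs (rotate1 ?vs))" for F G
    by (rule successively_cyclic_zip[OF _ _ that]) simp
  then have "set (zip ?vs (rotate1 ?vs)) \<subseteq> parcs ?G" by (rule subrelI)
  moreover have "distinct ?vs"
    using xs(1) by (auto simp: distinct_map inj_on_def)
  moreover have "set ?vs = pverts ?G"
    using xs(2) by (simp add: assoc_faces_def cover_graph_def)
  moreover have "3 \<le> length ?vs" using len by simp
  ultimately show ?thesis unfolding hamiltonian_iff_list by (intro exI[of _ ?vs] conjI)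
qed

end
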